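(* Let $G$ be a graph. With Minimizer responding (and Maximizer initiating) in both games, the value of the unrooted-$P_3$-game on $G$ is at most the value of the stripe-game on $G$.
   Context: Graphs are finite, simple and undirected. $P_3$ is the path on three vertices; copies of $P_3$ in a graph are subgraphs, not necessarily induced. Both games are played on $G$ by two players, Maximizer and Minimizer; throughout a game one of them is the initiator and the other is the responder. In each round of the stripe-game, the initiator chooses a vertex $v$ of the current graph such that the current graph contains at least one copy of $P_3$ with $v$ as an end-vertex, and the responder then chooses one copy of $P_3$ in the current graph with $v$ as an end-vertex. In each round of the unrooted-$P_3$-game, the initiator chooses a vertex $v$ of the current graph that lies in at least one copy of $P_3$ in the current graph, and the responder then chooses one copy of $P_3$ in the current graph containing $v$ (in any position). In both games, the three vertices of the chosen copy are then removed, and the next round is played on the subgraph induced by the remaining vertices; the game ends when the remaining graph contains no copy of $P_3$. Maximizer tries to maximize, and Minimizer tries to minimize, the number of copies of $P_3$ taken. The value of a game is the number of copies taken under optimal play by both players. *)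

theory Defs
  imports Main
begin

text \<open>A graph is a pair of a vertex set and a set of edges, an edge being the set of its two ends.\<close>

type_synonym 'a graph = "'a set \<times> 'a set set"

abbreviation verts :: "'a graph \<Rightarrow> 'a set" where
  "verts G \<equiv> fst G"

abbreviation edges :: "'a graph \<Rightarrow> 'a set set" where
  "edges G \<equiv> snd G"

definition simple_graph :: "'a graph \<Rightarrow> bool" where
  "simple_graph G \<longleftrightarrow> finite (verts G) \<and> (\<forall>e \<in> edges G. e \<subseteq> verts G \<and> card e = 2)"

definition subgraph :: "'a graph \<Rightarrow> 'a graph \<Rightarrow> bool" where
  "subgraph H G \<longleftrightarrow> verts H \<subseteq> verts G \<and> edges H \<subseteq> edges G"

definition delete_verts :: "'a graph \<Rightarrow> 'a set \<Rightarrow> 'a graph" where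
  "delete_verts G W = (verts G - W, {e \<in> edges G. e \<subseteq> verts G - W})"

definition path3 :: "'a \<Rightarrow> 'a \<Rightarrow> 'a \<Rightarrow> 'a graph" where
  "path3 a b c = ({a, b, c}, {{a, b}, {b, c}})"

definition P3_copies :: "'a graph \<Rightarrow> 'a graph set" where
  "P3_copies G = {H. subgraph H G \<and> (\<exists>a b c. distinct [a, b, c] \<and> H = path3 a b c)}"

definition P3_end :: "'a graph \<Rightarrow> 'a \<Rightarrow> bool" where
  "P3_end H v \<longleftrightarrow> (\<exists>b c. distinct [v, b, c] \<and> H = path3 v b c)"

datatype game = Stripe | Unrooted

text \<open>The copies from which the responder may choose once the initiator has chosen \<open>v\<close>.\<close>

fun replies :: "game \<Rightarrow> 'a graph \<Rightarrow> 'a \<Rightarrow> 'a graph set" where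
  "replies Stripe G v = {H \<in> P3_copies G. P3_end H v}"
| "replies Unrooted G v = {H \<in> P3_copies G. v \<in> verts H}"

definition choices :: "game \<Rightarrow> 'a graph \<Rightarrow> 'a set" where
  "choices g G = {v \<in> verts G. replies g G v \<noteq> {}}"

lemma replies_subset: "replies g G v \<subseteq> P3_copies G"
  by (cases g) auto

lemma simple_graph_delete_verts: "simple_graph G \<Longrightarrow> simple_graph (delete_verts G W)"
  by (auto simp: simple_graph_def delete_verts_def)

lemma card_verts_delete_copy:
  assumes "simple_graph G" and "H \<in> P3_copies G"
  shows "card (verts (delete_verts G (verts H))) < card (verts G)"
proof (rule psubset_card_mono)
  show "finite (verts G)"
    using assms(1) by (simp add: simple_graph_def)
  show "verts (delete_verts G (verts H)) \<subset> verts G"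
    using assms(2) by (auto simp: P3_copies_def subgraph_def path3_def delete_verts_def)
qed

text \<open>The value when Maximizer is the initiator and Minimizer the responder, by backward induction.
  The test for \<open>simple_graph\<close> only serves termination: the value is meaningless otherwise.
  For a simple graph containing a copy of \<open>P\<^sub>3\<close>, every \<open>Max\<close> and \<open>Min\<close> below is taken over
  a finite nonempty set.\<close>

function value_min_resp :: "game \<Rightarrow> 'a graph \<Rightarrow> nat" where
  "value_min_resp g G =
     (if \<not> simple_graph G \<or> P3_copies G = {} then 0
      else Max ((\<lambda>v. Min ((\<lambda>H. 1 + value_min_resp g (delete_verts G (verts H))) ` replies g G v))
                ` choices g G))"
  by pat_completeness auto
termination
proof (relation "Wellfounded.measure (\<lambda>(g, G). card (verts G))", goal_cases)
  case 1
  show ?case by simp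
next
  case (2 g G v H)
  then have "H \<in> P3_copies G"
    by (auto intro: subsetD [OF replies_subset])
  with 2 show ?case
    by (simp add: card_verts_delete_copy)
qed

declare value_min_resp.simps [simp del]

lemma finite_P3_copies:
  assumes "simple_graph G"
  shows "finite (P3_copies G)"
proof -
  have "P3_copies G \<subseteq> (\<lambda>(a, b, c). path3 a b c) ` (verts G \<times> verts G \<times> verts G)"
    by (force simp: P3_copies_def subgraph_def path3_def)
  then show ?thesis
    using assms by (meson finite_SigmaI finite_imageI finite_subset simple_graph_def)
qed

lemma finite_replies: "simple_graph G \<Longrightarrow> finite (replies g G v)"
  using finite_P3_copies finite_subset replies_subset by metis

lemma finite_choices: "simple_graph G \<Longrightarrow> finite (choices g G)"
  by (simp add: choices_def simple_graph_def)

lemma choices_nonempty: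
  assumes "P3_copies G \<noteq> {}"
  shows "choices g G \<noteq> {}"
proof -
  obtain a b c where abc: "distinct [a, b, c]" "path3 a b c \<in> P3_copies G"
    using assms unfolding P3_copies_def by blast
  then have "path3 a b c \<in> replies g G a"
    by (cases g) (auto simp: P3_end_def, auto simp: path3_def)
  moreover have "a \<in> verts G"
    using abc by (auto simp: P3_copies_def subgraph_def path3_def)
  ultimately show ?thesis
    by (auto simp: choices_def)
qed

end

theory Submission
  imports Defs
begin

text \<open>Whatever vertex \<open>v\<close> the Maximizer chooses in the unrooted game, the stripe game offers
  a choice \<open>w\<close> that leaves the Minimizer no reply beyond those available against \<open>v\<close>
  (\<open>stripe_choice_restricting_replies\<close>). If some copy of \<open>P\<^sub>3\<close> ends in \<open>v\<close>, then \<open>w = v\<close> works,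
  because a copy with end \<open>v\<close> contains \<open>v\<close>. Otherwise \<open>v\<close> is only ever a middle vertex, so its
  component is a star centred at \<open>v\<close>; with \<open>w\<close> a leaf of that star, every copy ending in \<open>w\<close>
  passes through \<open>v\<close>.

  A copy taken after \<open>w\<close> could therefore have been taken after \<open>v\<close>, and both games go on from
  the same remaining graph. Induction on the number of vertices compares the two values there.\<close>

lemma path3_in_P3_copies_iff:
  assumes "simple_graph G" and "distinct [a, b, c]"
  shows "path3 a b c \<in> P3_copies G \<longleftrightarrow> {a, b} \<in> edges G \<and> {b, c} \<in> edges G"
proof
  assume "path3 a b c \<in> P3_copies G"
  then show "{a, b} \<in> edges G \<and> {b, c} \<in> edges G"
    by (auto simp: P3_copies_def subgraph_def path3_def)
next
  assume "{a, b} \<in> edges G \<and> {b, c} \<in> edges G"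
  then have "subgraph (path3 a b c) G"
    using assms(1) by (auto simp: simple_graph_def subgraph_def path3_def)
  with assms(2) show "path3 a b c \<in> P3_copies G"
    unfolding P3_copies_def by blast
qed

lemma verts_path3 [simp]: "verts (path3 a b c) = {a, b, c}"
  by (simp add: path3_def)

lemma replies_StripeE:
  assumes "H \<in> replies Stripe G v"
  obtains b c where "distinct [v, b, c]" "H = path3 v b c" "path3 v b c \<in> P3_copies G"
  using assms by (auto simp: P3_end_def)

lemma replies_StripeI:
  assumes "distinct [v, b, c]" and "path3 v b c \<in> P3_copies G"
  shows "path3 v b c \<in> replies Stripe G v"
  using assms by (auto simp: P3_end_def)

lemma replies_Stripe_subset_Unrooted: "replies Stripe G v \<subseteq> replies Unrooted G v"
  by (auto elim!: replies_StripeE simp del: replies.simps(1))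

text \<open>Two steps from \<open>x\<close> can avoid its neighbour \<open>v\<close> only by starting with another neighbour
  \<open>b\<close> of \<open>x\<close>; but then \<open>v\<close>, \<open>x\<close>, \<open>b\<close> is a path that ends in \<open>v\<close>.\<close>

lemma replies_at_leaf_contain_centre:
  assumes G: "simple_graph G"
    and no_end: "replies Stripe G v = {}"
    and vx: "{v, x} \<in> edges G" "v \<noteq> x"
    and H: "H \<in> replies Stripe G x"
  shows "v \<in> verts H"
proof -
  obtain b c where bc: "distinct [x, b, c]" "H = path3 x b c" "path3 x b c \<in> P3_copies G"
    using H by (rule replies_StripeE)
  have "b = v"
  proof (rule ccontr)
    assume "b \<noteq> v"
    with bc(1) vx(2) have d: "distinct [v, x, b]" by auto
    have "{x, b} \<in> edges G"
      using bc(3) by (simp only: path3_in_P3_copies_iff [OF G bc(1)])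
    with vx(1) d have "path3 v x b \<in> P3_copies G"
      by (simp add: path3_in_P3_copies_iff [OF G])
    with d have "path3 v x b \<in> replies Stripe G v"
      by (rule replies_StripeI)
    with no_end show False
      by blast
  qed
  with bc(2) show ?thesis by simp
qed

lemma stripe_choice_restricting_replies:
  assumes G: "simple_graph G" and v: "v \<in> choices Unrooted G"
  shows "\<exists>w \<in> choices Stripe G. replies Stripe G w \<subseteq> replies Unrooted G v"
proof (cases "replies Stripe G v = {}")
  case False
  with v have "v \<in> choices Stripe G"
    by (simp add: choices_def)
  then show ?thesis
    using replies_Stripe_subset_Unrooted [of G v] by blast
next
  case True
  obtain a b c where abc: "distinct [a, b, c]" "path3 a b c \<in> P3_copies G" "v \<in> {a, b, c}"
  proof -
    obtain H where "H \<in> P3_copies G" "v \<in> verts H"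
      using v by (auto simp: choices_def)
    moreover then obtain a b c where "distinct [a, b, c]" "H = path3 a b c"
      unfolding P3_copies_def by blast
    ultimately show thesis
      by (intro that [of a b c]) auto
  qed
  have ab: "{a, b} \<in> edges G" and bc: "{b, c} \<in> edges G"
    using abc(2) by (simp_all only: path3_in_P3_copies_iff [OF G abc(1)])
  have "v \<noteq> a"
    using True replies_StripeI [OF abc(1,2)] by (auto simp del: replies.simps)
  moreover have "v \<noteq> c"
  proof
    assume "v = c"
    have d: "distinct [c, b, a]"
      using abc(1) by auto
    with ab bc have "path3 c b a \<in> P3_copies G"
      by (simp add: path3_in_P3_copies_iff [OF G] insert_commute)
    with d have "path3 c b a \<in> replies Stripe G c"
      by (rule replies_StripeI)
    with True \<open>v = c\<close> show False
      by (simp del: replies.simps)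
  qed
  ultimately have "v = b"
    using abc(3) by simp
  have "a \<in> choices Stripe G"
    using replies_StripeI [OF abc(1,2)] abc(2)
    by (auto simp: choices_def P3_copies_def subgraph_def simp del: replies.simps)
  moreover have "replies Stripe G a \<subseteq> replies Unrooted G v"
  proof
    fix H assume H: "H \<in> replies Stripe G a"
    have "v \<in> verts H"
      by (rule replies_at_leaf_contain_centre [OF G True _ \<open>v \<noteq> a\<close> H])
        (use ab \<open>v = b\<close> in \<open>simp add: insert_commute\<close>)
    with H show "H \<in> replies Unrooted G v"
      by simp
  qed
  ultimately show ?thesis by blast
qed

text \<open>The two halves of backward induction: a bound from above needs one good reply to each
  choice, a bound from below needs one choice that is good against all replies.\<close>

lemma value_min_resp_le:
  assumes G: "simple_graph G"
    and bound: "\<And>v. v \<in> choices g G \<Longrightarrow>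
      \<exists>H \<in> replies g G v. 1 + value_min_resp g (delete_verts G (verts H)) \<le> n"
  shows "value_min_resp g G \<le> n"
proof (cases "P3_copies G = {}")
  case True
  then show ?thesis by (subst value_min_resp.simps) simp
next
  case False
  have "Min ((\<lambda>H. 1 + value_min_resp g (delete_verts G (verts H))) ` replies g G v) \<le> n"
    if v: "v \<in> choices g G" for v
  proof -
    obtain H where "H \<in> replies g G v" "1 + value_min_resp g (delete_verts G (verts H)) \<le> n"
      using bound [OF v] by blast
    then show ?thesis
      using finite_replies [OF G] by (intro Min_le_iff [THEN iffD2]) auto
  qed
  then show ?thesis
    using False G finite_choices [OF G, of g] choices_nonempty [OF False, of g]
    by (subst value_min_resp.simps) simp
qed

lemma value_min_resp_ge:
  assumes G: "simple_graph G" and w: "w \<in> choices g G"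
    and bound: "\<And>H. H \<in> replies g G w \<Longrightarrow>
      n \<le> 1 + value_min_resp g (delete_verts G (verts H))"
  shows "n \<le> value_min_resp g G"
proof -
  let ?m = "\<lambda>v. Min ((\<lambda>H. 1 + value_min_resp g (delete_verts G (verts H))) ` replies g G v)"
  have ne: "replies g G w \<noteq> {}"
    using w by (simp add: choices_def)
  then have "P3_copies G \<noteq> {}"
    using replies_subset [of g G w] by blast
  then have eq: "value_min_resp g G = Max (?m ` choices g G)"
    using G by (subst value_min_resp.simps) simp
  have "n \<le> ?m w"
    using ne finite_replies [OF G] bound by (intro Min.boundedI) auto
  also have "\<dots> \<le> Max (?m ` choices g G)"
    using w finite_choices [OF G] by (intro Max_ge) auto
  finally show ?thesis
    by (simp only: eq)
qed

theorem theorem20: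
  fixes G :: "'a graph"
  assumes "simple_graph G"
  shows "value_min_resp Unrooted G \<le> value_min_resp Stripe G"
  using assms
proof (induction "card (verts G)" arbitrary: G rule: less_induct)
  case less
  note G = \<open>simple_graph G\<close>
  show ?case
  proof (rule value_min_resp_le [OF G])
    fix v assume "v \<in> choices Unrooted G"
    then obtain w where w: "w \<in> choices Stripe G"
      and sub: "replies Stripe G w \<subseteq> replies Unrooted G v"
      using stripe_choice_restricting_replies [OF G] by blast
    show "\<exists>H \<in> replies Unrooted G v.
        1 + value_min_resp Unrooted (delete_verts G (verts H)) \<le> value_min_resp Stripe G"
    proof (rule ccontr)
      assume contra: "\<not> ?thesis"
      have large: "value_min_resp Stripe G + 1
          \<le> 1 + value_min_resp Unrooted (delete_verts G (verts H))"
        if "H \<in> replies Unrooted G v" for H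
        proof -
        have "\<not> 1 + value_min_resp Unrooted (delete_verts G (verts H)) \<le> value_min_resp Stripe G"
          using contra that by blast
        then show ?thesis by linarith
      qed
      have "value_min_resp Stripe G + 1 \<le> value_min_resp Stripe G"
      proof (rule value_min_resp_ge [OF G w])
        fix H assume H: "H \<in> replies Stripe G w"
        then have "H \<in> P3_copies G"
          using replies_subset [of Stripe G w] by blast
        then have "value_min_resp Unrooted (delete_verts G (verts H))
            \<le> value_min_resp Stripe (delete_verts G (verts H))"
          by (intro less.hyps card_verts_delete_copy simple_graph_delete_verts G)
        moreover have "value_min_resp Stripe G + 1
            \<le> 1 + value_min_resp Unrooted (delete_verts G (verts H))"
          using H sub by (intro large) blast
        ultimately show "value_min_resp Stripe G + 1
            \<le> 1 + value_min_resp Stripe (delete_verts G (verts H))"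
          by linarith
      qed
      then show False by simp
    qed
  qed
qed

end
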